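(* Let $E$ be an arbitrary directed graph, $K$ any field, $v$ a line point in $E$, and $R=L_K(E)$. The $K$-vector space $K[[F^+_E(T(v))]]$ is a left $R$-premodule (via the action in which $u\in E^0$, $e\in E^1$ and $e^*$ act as the endomorphisms $P_u$, $S_e$ and $S_{e^*}$, respectively), while $K[[F^+_E(T(v))]]^{sf}$ is a (unitary) left $R$-module under this action. Indeed, \[K[[F^+_E(T(v))]]^{sf}=R\cdot K[[F^+_E(T(v))]].\]
   Context: Leavitt path algebra: for a directed graph $E=(E^0,E^1,s,r)$ and a field $K$, $L_K(E)$ is the associative $K$-algebra (not necessarily unital) generated by $\{u: u\in E^0\}\cup\{e,e^*: e\in E^1\}$ subject to: $uw=\delta_{u,w}u$ for $u,w\in E^0$; $s(e)e=e=e\,r(e)$ and $r(e)e^*=e^*=e^*s(e)$ for $e\in E^1$; (CK1) $e^*f=\delta_{e,f}r(e)$ for $e,f\in E^1$; (CK2) $u=\sum_{e\in s^{-1}(u)}ee^*$ for every regular vertex $u$ (i.e. $0<|s^{-1}(u)|<\infty$). A left $R$-premodule is an abelian group with a (standard, possibly non-unitary) left $R$-action; it is a left $R$-module if in addition $RM=M$. Paths are vertices, or finite sequences $e_1\cdots e_m$ of edges with $r(e_i)=s(e_{i+1})$. $T(v)$ is the set of vertices $w$ such that there is a path from $v$ to $w$. $v$ is a line point if no vertex of $T(v)$ emits two or more edges or is the base of a cycle; then for $w\in T(v)$, $p_{v,w}$ denotes the unique path from $v$ to $w$. $F^+_E(T(v))$ is the disjoint union of $T(v)$ and the set of paths $e_1\cdots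 e_n$ ($n\ge1$) with $s(e_1)\notin T(v)$, $r(e_i)\notin T(v)$ for $1\le i<n$, and $r(e_n)\in T(v)$. $K[[F^+_E(T(v))]]$ is the $K$-space of all functions $\mathfrak p:F^+_E(T(v))\to K$, written as formal series $\mathfrak p=\sum_{\mu}k_\mu\,\mu p^*_{v,r(\mu)}$ with $k_\mu=\mathfrak p(\mu)$. $\mathfrak p$ is source finite if $\{s(\mu):\mathfrak p(\mu)\ne0\}$ is finite; $K[[F^+_E(T(v))]]^{sf}$ is the subspace of source finite series. The $K$-endomorphisms of $K[[F^+_E(T(v))]]$ are, for $u\in E^0$, $e\in E^1$: $P_u(\mathfrak p)(\mu)=\mathfrak p(\mu)$ if $s(\mu)=u$, and $0$ otherwise. If $s(e)\notin T(v)$: $S_e(\mathfrak p)(\mu)=\mathfrak p(\mu')$ if $\mu=e\mu'$, and $0$ otherwise; $S_{e^*}(\mathfrak p)(\mu)=\mathfrak p(e\mu)$ if $s(\mu)=r(e)$, and $0$ otherwise. If $s(e)\in T(v)$: $S_e(\mathfrak p)(\mu)=\mathfrak p(r(e))$ if $\mu=s(e)$, and $0$ otherwise; $S_{e^*}(\mathfrak p)(\mu)=\mathfrak p(s(e))$ if $\mu=r(e)$, and $0$ otherwise. $R\cdot K[[F^+_E(T(v))]]$ denotes the additive span of the products $x\cdot\mathfrak p$, $x\in R$, $\mathfrak p\in K[[F^+_E(T(v))]]$. *)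

theory Defs
  imports
    "HOL-Library.Poly_Mapping"
    "HOL-Algebra.QuotRing"
    "HOL-Algebra.Module"
    "HOL-Algebra.Generated_Groups"
    "Graph_Theory.Arc_Walk"
begin

section \<open>Free associative algebras\<close>

text \<open>
  The free monoid on \<open>'g\<close>, written additively, so that
  \<open>'g word \<Rightarrow>\<^sub>0 'k\<close> with the convolution product of
  \<^theory>\<open>HOL-Library.Poly_Mapping\<close> is the free unital
  associative algebra over \<open>'k\<close>.
\<close>

datatype 'g word = Word (letters: "'g list")

instantiation word :: (type) monoid_add
begin

definition zero_word :: "'a word" where
  "zero_word = Word []"

definition plus_word :: "'a word \<Rightarrow> 'a word \<Rightarrow> 'a word" where
  "x + y = Word (letters x @ letters y)"

instance
  by standard (simp_all add: zero_word_def plus_word_def)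

end

definition scalar :: "'k::field \<Rightarrow> ('g word \<Rightarrow>\<^sub>0 'k)" where
  "scalar k = Poly_Mapping.single 0 k"

definition gen :: "'g \<Rightarrow> ('g word \<Rightarrow>\<^sub>0 'k::field)" where
  "gen g = Poly_Mapping.single (Word [g]) 1"

definition free_algebra :: "'g set \<Rightarrow> ('g word \<Rightarrow>\<^sub>0 'k::field) ring" where
  "free_algebra X =
     \<lparr>carrier = {f. \<forall>w\<in>Poly_Mapping.keys f. set (letters w) \<subseteq> X},
      mult = (*), one = 1, zero = 0, add = (+)\<rparr>"

text \<open>The underlying set of the free non-unital algebra: no constant terms.\<close>

definition free_nonunital :: "'g set \<Rightarrow> ('g word \<Rightarrow>\<^sub>0 'k::field) set" where
  "free_nonunital X = {f \<in> carrier (free_algebra X). 0 \<notin> Poly_Mapping.keys f}"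


section \<open>Leavitt path algebras\<close>

text \<open>
  The source map \<open>s\<close> is \<^const>\<open>tail\<close> and the range map
  \<open>r\<close> is \<^const>\<open>head\<close>; \<open>Ghost e\<close> stands for \<open>e\<^sup>*\<close>.
\<close>

datatype ('a, 'b) lpa_gen = Vertex 'a | Edge 'b | Ghost 'b

type_synonym ('a, 'b, 'k) lpa_free = "('a, 'b) lpa_gen word \<Rightarrow>\<^sub>0 'k"
type_synonym ('a, 'b, 'k) lpa_elem = "('a, 'b, 'k) lpa_free set"

definition lpa_gens :: "('a, 'b) pre_digraph \<Rightarrow> ('a, 'b) lpa_gen set" where
  "lpa_gens E = Vertex ` verts E \<union> Edge ` arcs E \<union> Ghost ` arcs E"

definition regular_vertex :: "('a, 'b) pre_digraph \<Rightarrow> 'a \<Rightarrow> bool" where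
  "regular_vertex E u \<longleftrightarrow> u \<in> verts E \<and> finite (out_arcs E u) \<and> out_arcs E u \<noteq> {}"

definition lpa_relations :: "('a, 'b) pre_digraph \<Rightarrow> ('a, 'b, 'k::field) lpa_free set" where
  "lpa_relations E =
     {gen (Vertex u) * gen (Vertex w) - (if u = w then gen (Vertex u) else 0) | u w.
        u \<in> verts E \<and> w \<in> verts E} \<union>
     {gen (Vertex (tail E e)) * gen (Edge e) - gen (Edge e) | e. e \<in> arcs E} \<union>
     {gen (Edge e) * gen (Vertex (head E e)) - gen (Edge e) | e. e \<in> arcs E} \<union>
     {gen (Vertex (head E e)) * gen (Ghost e) - gen (Ghost e) | e. e \<in> arcs E} \<union>
     {gen (Ghost e) * gen (Vertex (tail E e)) - gen (Ghost e) | e. e \<in> arcs E} \<union>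
     {gen (Ghost e) * gen (Edge f) - (if e = f then gen (Vertex (head E e)) else 0) | e f.
        e \<in> arcs E \<and> f \<in> arcs E} \<union>
     {gen (Vertex u) - (\<Sum>e\<in>out_arcs E u. gen (Edge e) * gen (Ghost e)) | u.
        regular_vertex E u}"

definition lpa_ideal :: "('a, 'b) pre_digraph \<Rightarrow> ('a, 'b, 'k::field) lpa_free set" where
  "lpa_ideal E = genideal (free_algebra (lpa_gens E)) (lpa_relations E)"

text \<open>The quotient of the free unital algebra by the relations; it only serves as ambient ring.\<close>

definition lpa_quot :: "('a, 'b) pre_digraph \<Rightarrow> ('a, 'b, 'k::field) lpa_elem ring" where
  "lpa_quot E = free_algebra (lpa_gens E) Quot lpa_ideal E"

definition lpa_class ::
    "('a, 'b) pre_digraph \<Rightarrow> ('a, 'b, 'k::field) lpa_free \<Rightarrow> ('a, 'b, 'k) lpa_elem" where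
  "lpa_class E f = lpa_ideal E +>\<^bsub>free_algebra (lpa_gens E)\<^esub> f"

text \<open>
  The algebra \<open>L\<^sub>K(E)\<close> consists of the classes of the elements without constant
  term. Since all relations lie in the free non-unital algebra, and the two-sided ideals of that
  algebra stable under scalars are the ideals of the free unital algebra contained in it, this is
  the non-unital algebra presented by the generators and relations. In general it has no unit
  element, and the field \<^const>\<open>one\<close> of the record is then meaningless.
\<close>

definition lpa :: "('a, 'b) pre_digraph \<Rightarrow> ('k::field, ('a, 'b, 'k) lpa_elem) module" where
  "lpa E =
     \<lparr>carrier = lpa_class E ` free_nonunital (lpa_gens E),
      mult = mult (lpa_quot E), one = one (lpa_quot E),
      zero = zero (lpa_quot E), add = add (lpa_quot E),
      smult = (\<lambda>k x. lpa_class E (scalar k) \<otimes>\<^bsub>lpa_quot E\<^esub> x)\<rparr>"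


section \<open>Premodules and modules over rings without unit\<close>

text \<open>
  Only the additive structure of \<open>M\<close> matters, and \<open>R\<close> need not
  have a unit element.
\<close>

locale premodule = abelian_group M
  for R :: "('r, 'x) ring_scheme" and M :: "('m, 'y) ring_scheme"
    and act :: "'r \<Rightarrow> 'm \<Rightarrow> 'm" +
  assumes act_closed: "x \<in> carrier R \<Longrightarrow> p \<in> carrier M \<Longrightarrow> act x p \<in> carrier M"
    and act_add_left: "x \<in> carrier R \<Longrightarrow> y \<in> carrier R \<Longrightarrow> p \<in> carrier M \<Longrightarrow>
      act (x \<oplus>\<^bsub>R\<^esub> y) p = act x p \<oplus>\<^bsub>M\<^esub> act y p"
    and act_add_right: "x \<in> carrier R \<Longrightarrow> p \<in> carrier M \<Longrightarrow> q \<in> carrier M \<Longrightarrow>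
      act x (p \<oplus>\<^bsub>M\<^esub> q) = act x p \<oplus>\<^bsub>M\<^esub> act x q"
    and act_mult: "x \<in> carrier R \<Longrightarrow> y \<in> carrier R \<Longrightarrow> p \<in> carrier M \<Longrightarrow>
      act (x \<otimes>\<^bsub>R\<^esub> y) p = act x (act y p)"

definition act_span ::
    "('r, 'x) ring_scheme \<Rightarrow> ('m, 'y) ring_scheme \<Rightarrow> ('r \<Rightarrow> 'm \<Rightarrow> 'm) \<Rightarrow> 'm set" where
  "act_span R M act = generate (add_monoid M) {act x p | x p. x \<in> carrier R \<and> p \<in> carrier M}"

locale unitary_module = premodule R M act
  for R :: "('r, 'x) ring_scheme" and M :: "('m, 'y) ring_scheme"
    and act :: "'r \<Rightarrow> 'm \<Rightarrow> 'm" +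
  assumes unitary: "act_span R M act = carrier M"


section \<open>Line points and the paths entering the tree of a vertex\<close>

definition tree_of :: "('a, 'b) pre_digraph \<Rightarrow> 'a \<Rightarrow> 'a set" where
  "tree_of E v = {w. \<exists>es. pre_digraph.awalk E v es w}"

definition line_point :: "('a, 'b) pre_digraph \<Rightarrow> 'a \<Rightarrow> bool" where
  "line_point E v \<longleftrightarrow> v \<in> verts E \<and>
     (\<forall>w\<in>tree_of E v.
        \<not> (\<exists>e\<in>out_arcs E w. \<exists>f\<in>out_arcs E w. e \<noteq> f) \<and>
        \<not> (\<exists>c. pre_digraph.cycle E c \<and> pre_digraph.awalk E w c w))"

text \<open>
  A path is encoded as the pair of its source and its list of edges: the vertex \<open>w\<close>
  is \<open>(w, [])\<close>, and \<open>e\<^sub>1\<dots>e\<^sub>n\<close> is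
  \<open>(tail E e\<^sub>1, [e\<^sub>1, \<dots>, e\<^sub>n])\<close>.
\<close>

type_synonym ('a, 'b) path = "'a \<times> 'b list"

definition entry_paths :: "('a, 'b) pre_digraph \<Rightarrow> 'a \<Rightarrow> ('a, 'b) path set" where
  "entry_paths E v =
     {(w, []) | w. w \<in> tree_of E v} \<union>
     {(u, es) | u es. es \<noteq> [] \<and> (\<exists>w. pre_digraph.awalk E u es w) \<and> u \<notin> tree_of E v \<and>
        (\<forall>e\<in>set (butlast es). head E e \<notin> tree_of E v) \<and> head E (last es) \<in> tree_of E v}"


section \<open>Formal series\<close>

text \<open>
  Functions on \<^const>\<open>entry_paths\<close> are encoded as functions on all pairs that vanish
  elsewhere. The multiplicative part of the record is not used.
\<close>

type_synonym ('a, 'b, 'k) series = "('a, 'b) path \<Rightarrow> 'k"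

definition path_series ::
    "('a, 'b) pre_digraph \<Rightarrow> 'a \<Rightarrow> ('k::field, ('a, 'b, 'k) series) module" where
  "path_series E v =
     \<lparr>carrier = {p. \<forall>\<mu>. \<mu> \<notin> entry_paths E v \<longrightarrow> p \<mu> = 0},
      mult = undefined, one = undefined,
      zero = (\<lambda>_. 0), add = (\<lambda>p q \<mu>. p \<mu> + q \<mu>),
      smult = (\<lambda>k p \<mu>. k * p \<mu>)\<rparr>"

definition source_finite :: "('a, 'b, 'k::field) series \<Rightarrow> bool" where
  "source_finite p \<longleftrightarrow> finite (fst ` {\<mu>. p \<mu> \<noteq> 0})"

definition path_series_sf ::
    "('a, 'b) pre_digraph \<Rightarrow> 'a \<Rightarrow> ('k::field, ('a, 'b, 'k) series) module" where
  "path_series_sf E v =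
     (path_series E v)\<lparr>carrier := {p \<in> carrier (path_series E v). source_finite p}\<rparr>"

definition op_vertex :: "'a \<Rightarrow> ('a, 'b, 'k::field) series \<Rightarrow> ('a, 'b, 'k) series" where
  "op_vertex u p = (\<lambda>\<mu>. if fst \<mu> = u then p \<mu> else 0)"

definition op_edge ::
    "('a, 'b) pre_digraph \<Rightarrow> 'a \<Rightarrow> 'b \<Rightarrow> ('a, 'b, 'k::field) series \<Rightarrow> ('a, 'b, 'k) series" where
  "op_edge E v e p =
     (if tail E e \<notin> tree_of E v
      then (\<lambda>(u, es). case es of
              [] \<Rightarrow> 0
            | f # fs \<Rightarrow> if u = tail E e \<and> f = e then p (head E e, fs) else 0)
      else (\<lambda>\<mu>. if \<mu> = (tail E e, []) then p (head E e, []) else 0))"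

definition op_ghost ::
    "('a, 'b) pre_digraph \<Rightarrow> 'a \<Rightarrow> 'b \<Rightarrow> ('a, 'b, 'k::field) series \<Rightarrow> ('a, 'b, 'k) series" where
  "op_ghost E v e p =
     (if tail E e \<notin> tree_of E v
      then (\<lambda>(u, es). if u = head E e then p (tail E e, e # es) else 0)
      else (\<lambda>\<mu>. if \<mu> = (head E e, []) then p (tail E e, []) else 0))"

text \<open>
  The defining property of the action on the series. Compatibility with scalars is
  required because the generators generate \<open>L\<^sub>K(E)\<close> only as an algebra, not as a ring.
\<close>

definition series_action ::
    "('a, 'b) pre_digraph \<Rightarrow> 'a \<Rightarrow>
     (('a, 'b, 'k::field) lpa_elem \<Rightarrow> ('a, 'b, 'k) series \<Rightarrow> ('a, 'b, 'k) series) \<Rightarrow> bool" where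
  "series_action E v act \<longleftrightarrow>
     premodule (lpa E) (path_series E v) act \<and>
     (\<forall>k. \<forall>x\<in>carrier (lpa E). \<forall>p\<in>carrier (path_series E v).
        act (k \<odot>\<^bsub>lpa E\<^esub> x) p = k \<odot>\<^bsub>path_series E v\<^esub> act x p \<and>
        act x (k \<odot>\<^bsub>path_series E v\<^esub> p) = k \<odot>\<^bsub>path_series E v\<^esub> act x p) \<and>
     (\<forall>p\<in>carrier (path_series E v).
        (\<forall>u\<in>verts E. act (lpa_class E (gen (Vertex u))) p = op_vertex u p) \<and>
        (\<forall>e\<in>arcs E. act (lpa_class E (gen (Edge e))) p = op_edge E v e p) \<and>
        (\<forall>e\<in>arcs E. act (lpa_class E (gen (Ghost e))) p = op_ghost E v e p))"

end

theory Submission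
  imports Defs
begin

text \<open>
  The free unital algebra acts on all functions on pairs, so the action of \<open>L\<^sub>K(E)\<close>
  exists as soon as the defining relations annihilate the series supported on entry paths. The
  line point hypothesis enters through the edges whose source lies in \<open>T(v)\<close>: such an
  edge is the only one leaving its source, which gives CK1 and CK2 there. A nonempty word
  begins with a generator, whose image consists of series with a single source;
  hence \<open>R \<cdot> M\<close> is source finite. Conversely, a source finite series is fixed by
  the sum of the finitely many vertices at which it is supported.
\<close>

section \<open>The free algebra\<close>

lemma free_algebra_simps [simp]:
  "mult (free_algebra X) = (*)" "one (free_algebra X) = 1"
  "zero (free_algebra X) = 0" "add (free_algebra X) = (+)"
  by (simp_all add: free_algebra_def)

lemma mem_free_algebra_iff:
  "f \<in> carrier (free_algebra X) \<longleftrightarrow> (\<forall>w\<in>Poly_Mapping.keys f. set (letters w) \<subseteq> X)"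
  by (simp add: free_algebra_def)

lemma free_algebra_closed:
  fixes f g :: "'g word \<Rightarrow>\<^sub>0 'k::field"
  shows "0 \<in> carrier (free_algebra X :: ('g word \<Rightarrow>\<^sub>0 'k) ring)"
    and "1 \<in> carrier (free_algebra X :: ('g word \<Rightarrow>\<^sub>0 'k) ring)"
    and "f \<in> carrier (free_algebra X) \<Longrightarrow> g \<in> carrier (free_algebra X) \<Longrightarrow>
      f + g \<in> carrier (free_algebra X)"
    and "f \<in> carrier (free_algebra X) \<Longrightarrow> g \<in> carrier (free_algebra X) \<Longrightarrow>
      f - g \<in> carrier (free_algebra X)"
    and "f \<in> carrier (free_algebra X) \<Longrightarrow> - f \<in> carrier (free_algebra X)"
    and "f \<in> carrier (free_algebra X) \<Longrightarrow> g \<in> carrier (free_algebra X) \<Longrightarrow>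
      f * g \<in> carrier (free_algebra X)"
    and "scalar c \<in> carrier (free_algebra X :: ('g word \<Rightarrow>\<^sub>0 'k) ring)"
    and "x \<in> X \<Longrightarrow> gen x \<in> carrier (free_algebra X :: ('g word \<Rightarrow>\<^sub>0 'k) ring)"
proof -
  assume "f \<in> carrier (free_algebra X)" "g \<in> carrier (free_algebra X)"
  then show "f * g \<in> carrier (free_algebra X)"
    using keys_mult[of f g] by (fastforce simp: mem_free_algebra_iff plus_word_def)
qed (use keys_add[of f g] keys_diff[of f g]
      in \<open>auto simp: mem_free_algebra_iff scalar_def gen_def zero_word_def dest!: subsetD\<close>)

lemma free_algebra_sum_closed:
  assumes "\<And>i. i \<in> A \<Longrightarrow> f i \<in> carrier (free_algebra X)"
  shows "(\<Sum>i\<in>A. f i) \<in> carrier (free_algebra X)"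
  using assms by (induction A rule: infinite_finite_induct) (auto intro: free_algebra_closed)

lemma ring_free_algebra: "ring (free_algebra X :: ('g word \<Rightarrow>\<^sub>0 'k::field) ring)"
proof (intro ringI abelian_groupI monoidI)
  fix x assume "x \<in> carrier (free_algebra X :: ('g word \<Rightarrow>\<^sub>0 'k) ring)"
  then show "\<exists>y\<in>carrier (free_algebra X).
      y \<oplus>\<^bsub>free_algebra X\<^esub> x = \<zero>\<^bsub>free_algebra X\<^esub>"
    by (intro bexI[of _ "- x"]) (auto intro: free_algebra_closed)
qed (auto intro: free_algebra_closed simp: algebra_simps)

lemma mem_free_nonunital_iff:
  "f \<in> free_nonunital X \<longleftrightarrow>
    (\<forall>w\<in>Poly_Mapping.keys f. set (letters w) \<subseteq> X \<and> letters w \<noteq> [])"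
  by (auto simp: free_nonunital_def mem_free_algebra_iff zero_word_def)
     (metis word.collapse)

lemma free_nonunital_subset: "free_nonunital X \<subseteq> carrier (free_algebra X)"
  by (auto simp: free_nonunital_def)

lemma free_nonunital_closed:
  "f \<in> free_nonunital X \<Longrightarrow> g \<in> free_nonunital X \<Longrightarrow> f + g \<in> free_nonunital X"
  "f \<in> free_nonunital X \<Longrightarrow> g \<in> free_nonunital X \<Longrightarrow> f * g \<in> free_nonunital X"
  "f \<in> free_nonunital X \<Longrightarrow> scalar c * f \<in> free_nonunital X"
  "x \<in> X \<Longrightarrow> gen x \<in> free_nonunital X"
  "0 \<in> free_nonunital X"
proof -
  assume f: "f \<in> free_nonunital X"
  then show "scalar c * f \<in> free_nonunital X"
    using keys_mult[of "scalar c" f]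
    by (fastforce simp: mem_free_nonunital_iff scalar_def split: if_splits)
  assume g: "g \<in> free_nonunital X"
  show "f + g \<in> free_nonunital X"
    using f g keys_add[of f g] by (fastforce simp: mem_free_nonunital_iff)
  show "f * g \<in> free_nonunital X"
    using f g keys_mult[of f g] by (fastforce simp: mem_free_nonunital_iff plus_word_def)
qed (auto simp: mem_free_nonunital_iff gen_def)

text \<open>A polynomial is the sum of its monomials. The monomial case ranges only over words
  occurring in \<open>f\<close>, so facts about those words, such as their letters or nonemptiness,
  stay available in the induction.\<close>

lemma poly_mapping_single_add_induct [case_names zero single add]:
  fixes f :: "'a \<Rightarrow>\<^sub>0 'b::comm_monoid_add"
  assumes zero: "P 0"
    and single: "\<And>w c. w \<in> Poly_Mapping.keys f \<Longrightarrow> P (Poly_Mapping.single w c)"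
    and add: "\<And>g h. P g \<Longrightarrow> P h \<Longrightarrow> P (g + h)"
  shows "P f"
proof -
  have "P (\<Sum>w\<in>A. Poly_Mapping.single w (Poly_Mapping.lookup f w))"
    if "finite A" "A \<subseteq> Poly_Mapping.keys f" for A
    using that by (induction A rule: finite_induct) (auto intro: zero single add)
  moreover have "(\<Sum>w\<in>Poly_Mapping.keys f. Poly_Mapping.single w (Poly_Mapping.lookup f w)) = f"
    by (rule poly_mapping_eqI)
       (auto simp: lookup_sum lookup_single when_def in_keys_iff cong: sum.cong)
  ultimately show ?thesis
    by (metis finite_keys order_refl)
qed


section \<open>The Leavitt path algebra as a quotient\<close>

lemma lpa_relations_subset:
  assumes "wf_digraph E"
  shows "lpa_relations E \<subseteq> carrier (free_algebra (lpa_gens E))"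
  using assms unfolding lpa_relations_def
  by (auto simp: lpa_gens_def wf_digraph_def regular_vertex_def
        intro!: free_algebra_closed free_algebra_sum_closed)

lemma lpa_ideal_ideal:
  assumes "wf_digraph E"
  shows "ideal (lpa_ideal E) (free_algebra (lpa_gens E))"
  unfolding lpa_ideal_def
  by (intro ring.genideal_ideal ring_free_algebra lpa_relations_subset assms)

lemma lpa_class_memD: "g \<in> lpa_class E f \<Longrightarrow> g - f \<in> lpa_ideal E"
  by (auto simp: lpa_class_def a_r_coset_def')

lemma lpa_carrier: "carrier (lpa E) = lpa_class E ` free_nonunital (lpa_gens E)"
  by (simp add: lpa_def)

context
  fixes E :: "('a, 'b) pre_digraph"
    and f :: "('a, 'b, 'k::field) lpa_free"
  assumes E: "wf_digraph E"
    and f: "f \<in> carrier (free_algebra (lpa_gens E))"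
begin

interpretation ideal "lpa_ideal E :: ('a, 'b, 'k) lpa_free set" "free_algebra (lpa_gens E)"
  by (rule lpa_ideal_ideal[OF E])

text \<open>The operations of \<open>lpa E\<close> are those of the ambient unital quotient, so this
  rule and the next also cover representatives with a constant term.\<close>

lemma lpa_class_add:
  "g \<in> carrier (free_algebra (lpa_gens E)) \<Longrightarrow>
    lpa_class E f \<oplus>\<^bsub>lpa E\<^esub> lpa_class E g = lpa_class E (f + g)"
  using a_rcos_sum[OF f, of g] by (simp add: lpa_def lpa_quot_def FactRing_def lpa_class_def)

lemma lpa_class_mult:
  "g \<in> carrier (free_algebra (lpa_gens E)) \<Longrightarrow>
    lpa_class E f \<otimes>\<^bsub>lpa E\<^esub> lpa_class E g = lpa_class E (f * g)"
  using rcoset_mult_add[OF f, of g] by (simp add: lpa_def lpa_quot_def FactRing_def lpa_class_def)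

lemma lpa_class_smult: "c \<odot>\<^bsub>lpa E\<^esub> lpa_class E f = lpa_class E (scalar c * f)"
  using rcoset_mult_add[OF free_algebra_closed(7)[of c "lpa_gens E"] f]
  by (simp add: lpa_def lpa_quot_def FactRing_def lpa_class_def)

lemma lpa_class_self: "f \<in> lpa_class E f"
  using a_rcos_self[OF f] by (simp add: lpa_class_def)

end


section \<open>Operators attached to words and polynomials\<close>

fun op_gen :: "('a, 'b) pre_digraph \<Rightarrow> 'a \<Rightarrow> ('a, 'b) lpa_gen \<Rightarrow>
    ('a, 'b, 'k::field) series \<Rightarrow> ('a, 'b, 'k) series" where
  "op_gen E v (Vertex u) = op_vertex u"
| "op_gen E v (Edge e) = op_edge E v e"
| "op_gen E v (Ghost e) = op_ghost E v e"

text \<open>The first letter of a word is applied last, as a left action requires; concatenation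
  then becomes composition.\<close>

definition op_word :: "('a, 'b) pre_digraph \<Rightarrow> 'a \<Rightarrow> ('a, 'b) lpa_gen word \<Rightarrow>
    ('a, 'b, 'k::field) series \<Rightarrow> ('a, 'b, 'k) series" where
  "op_word E v w = foldr (op_gen E v) (letters w)"

definition op_poly :: "('a, 'b) pre_digraph \<Rightarrow> 'a \<Rightarrow> ('a, 'b, 'k) lpa_free \<Rightarrow>
    ('a, 'b, 'k::field) series \<Rightarrow> ('a, 'b, 'k) series" where
  "op_poly E v f p =
    (\<lambda>\<mu>. \<Sum>w\<in>Poly_Mapping.keys f. Poly_Mapping.lookup f w * op_word E v w p \<mu>)"

lemmas op_defs = op_vertex_def op_edge_def op_ghost_def

section \<open>Linearity and multiplicativity of the operators\<close>

lemma op_gen_add: "op_gen E v x (\<lambda>\<mu>. p \<mu> + q \<mu>) = (\<lambda>\<mu>. op_gen E v x p \<mu> + op_gen E v x q \<mu>)"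
  by (cases x) (auto simp: op_defs fun_eq_iff split: list.split)

lemma op_gen_scale: "op_gen E v x (\<lambda>\<mu>. c * p \<mu>) = (\<lambda>\<mu>. c * op_gen E v x p \<mu>)"
  by (cases x) (auto simp: op_defs fun_eq_iff split: list.split)

lemma op_word_Word: "op_word E v (Word xs) = foldr (op_gen E v) xs"
  by (simp add: op_word_def)

lemma op_word_plus: "op_word E v (w + w') p = op_word E v w (op_word E v w' p)"
  by (simp add: op_word_def plus_word_def)

lemma op_word_add:
  "op_word E v w (\<lambda>\<mu>. p \<mu> + q \<mu>) = (\<lambda>\<mu>. op_word E v w p \<mu> + op_word E v w q \<mu>)"
proof (cases w)
  case (Word xs)
  then show ?thesis
    by (induction xs arbitrary: w) (simp_all add: op_word_Word op_gen_add)
qed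

lemma op_word_scale: "op_word E v w (\<lambda>\<mu>. c * p \<mu>) = (\<lambda>\<mu>. c * op_word E v w p \<mu>)"
proof (cases w)
  case (Word xs)
  then show ?thesis
    by (induction xs arbitrary: w) (simp_all add: op_word_Word op_gen_scale)
qed

lemma op_word_zero: "op_word E v w (\<lambda>_. 0) = (\<lambda>_. 0)"
  using op_word_scale[of E v w 0] by simp

text \<open>Coefficients vanish off the keys, so polynomials with different keys can be evaluated
  over one common index set. This absorbs cancellation in \<open>f + g\<close>.\<close>

lemma op_poly_superset:
  assumes "finite A" "Poly_Mapping.keys f \<subseteq> A"
  shows "op_poly E v f p = (\<lambda>\<mu>. \<Sum>w\<in>A. Poly_Mapping.lookup f w * op_word E v w p \<mu>)"
  unfolding op_poly_def
  by (rule ext, rule sum.mono_neutral_left) (use assms in \<open>auto simp: in_keys_iff\<close>)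

lemma op_poly_zero: "op_poly E v 0 p = (\<lambda>_. 0)"
  by (simp add: op_poly_def)

lemma op_poly_add: "op_poly E v (f + g) p = (\<lambda>\<mu>. op_poly E v f p \<mu> + op_poly E v g p \<mu>)"
  using keys_add[of f g]
  by (simp add: op_poly_superset[of "Poly_Mapping.keys f \<union> Poly_Mapping.keys g"]
        lookup_add sum.distrib distrib_right)

lemma op_poly_diff: "op_poly E v (f - g) p = (\<lambda>\<mu>. op_poly E v f p \<mu> - op_poly E v g p \<mu>)"
  using op_poly_add[of E v "f - g" g p] by (simp add: fun_eq_iff)

lemma op_poly_sum: "op_poly E v (\<Sum>i\<in>A. f i) p = (\<lambda>\<mu>. \<Sum>i\<in>A. op_poly E v (f i) p \<mu>)"
  by (induction A rule: infinite_finite_induct) (simp_all add: op_poly_zero op_poly_add)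

lemma op_poly_single: "op_poly E v (Poly_Mapping.single w c) p = (\<lambda>\<mu>. c * op_word E v w p \<mu>)"
  by (subst op_poly_superset[of "{w}"]) auto

lemma op_poly_gen: "op_poly E v (gen x) p = op_gen E v x p"
  by (simp add: gen_def op_poly_single op_word_def)

lemma op_poly_scalar: "op_poly E v (scalar c) p = (\<lambda>\<mu>. c * p \<mu>)"
  by (simp add: scalar_def op_poly_single op_word_def zero_word_def)

lemma op_poly_add_right:
  "op_poly E v f (\<lambda>\<mu>. p \<mu> + q \<mu>) = (\<lambda>\<mu>. op_poly E v f p \<mu> + op_poly E v f q \<mu>)"
  by (simp add: op_poly_def op_word_add sum.distrib distrib_left)

lemma op_poly_scale_right: "op_poly E v f (\<lambda>\<mu>. c * p \<mu>) = (\<lambda>\<mu>. c * op_poly E v f p \<mu>)"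
  by (simp add: op_poly_def op_word_scale sum_distrib_left mult.left_commute)

lemma op_poly_zero_right: "op_poly E v f (\<lambda>_. 0) = (\<lambda>_. 0)"
  by (simp add: op_poly_def op_word_zero)

text \<open>Both sides are additive in \<open>f\<close> and in \<open>g\<close>. This reduces the
  claim to two monomials, whose product concatenates words and multiplies coefficients.\<close>

lemma op_poly_mult: "op_poly E v (f * g) p = op_poly E v f (op_poly E v g p)"
proof (induction f rule: poly_mapping_single_add_induct)
  case zero
  then show ?case by (simp add: op_poly_zero)
next
  case (add f f')
  then show ?case by (simp add: distrib_right op_poly_add)
next
  case (single w c)
  show ?case
  proof (induction g rule: poly_mapping_single_add_induct)
    case zero
    then show ?case by (simp add: op_poly_zero op_poly_zero_right)
  next
    case (add g g')
    then show ?case by (simp add: distrib_left op_poly_add op_poly_add_right)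
  next
    case (single w' c')
    then show ?case
      by (simp add: mult_single op_poly_single op_word_plus op_word_scale mult.assoc)
  qed
qed


section \<open>Entry paths\<close>

context
  fixes E :: "('a, 'b) pre_digraph" and v :: 'a
  assumes E: "wf_digraph E"
begin

interpretation wf_digraph E by (rule E)

lemma tree_of_step: "e \<in> arcs E \<Longrightarrow> tail E e \<in> tree_of E v \<Longrightarrow> head E e \<in> tree_of E v"
  unfolding tree_of_def by (blast intro: awalk_appendI arc_implies_awalk)

lemma entry_paths_source:
  assumes "(u, es) \<in> entry_paths E v"
  shows "u \<in> verts E"
  using assms by (auto simp: entry_paths_def tree_of_def dest: awalk_last_in_verts)

lemma entry_paths_tree: "u \<in> tree_of E v \<Longrightarrow> (u, es) \<in> entry_paths E v \<longleftrightarrow> es = []"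
  by (auto simp: entry_paths_def)

lemma entry_paths_Nil: "(u, []) \<in> entry_paths E v \<longleftrightarrow> u \<in> tree_of E v"
  by (auto simp: entry_paths_def)

text \<open>After the first edge, \<open>head E e\<close> either lies in the tree, and the path
  stops there, or lies outside and becomes the source of a shorter entry path. Outside the tree,
  \<open>op_edge\<close> and \<open>op_ghost\<close> shift series along this correspondence.\<close>

lemma entry_paths_Cons:
  "(u, e # es) \<in> entry_paths E v \<longleftrightarrow>
    e \<in> arcs E \<and> u = tail E e \<and> u \<notin> tree_of E v \<and> (head E e, es) \<in> entry_paths E v"
proof (cases es)
  case Nil
  then show ?thesis
    by (auto simp: entry_paths_def awalk_Cons_iff awalk_Nil_iff)
next
  case (Cons f fs)
  then show ?thesis
    by (auto simp: entry_paths_def awalk_Cons_iff)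
qed

end

section \<open>Source finiteness, and stability of the series under the operators\<close>

lemma path_series_simps [simp]:
  "zero (path_series E v) = (\<lambda>_. 0)" "add (path_series E v) = (\<lambda>p q \<mu>. p \<mu> + q \<mu>)"
  "smult (path_series E v) = (\<lambda>k p \<mu>. k * p \<mu>)"
  "zero (path_series_sf E v) = (\<lambda>_. 0)" "add (path_series_sf E v) = (\<lambda>p q \<mu>. p \<mu> + q \<mu>)"
  by (simp_all add: path_series_def path_series_sf_def)

lemma mem_path_series_iff:
  "p \<in> carrier (path_series E v) \<longleftrightarrow> (\<forall>\<mu>. \<mu> \<notin> entry_paths E v \<longrightarrow> p \<mu> = 0)"
  by (simp add: path_series_def)

lemma mem_path_series_sf_iff:
  "p \<in> carrier (path_series_sf E v) \<longleftrightarrow> p \<in> carrier (path_series E v) \<and> source_finite p"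
  by (simp add: path_series_sf_def)

lemma source_finite_zero: "source_finite (\<lambda>_. 0)"
  by (simp add: source_finite_def)

lemma source_finite_add:
  assumes "source_finite p" "source_finite q"
  shows "source_finite (\<lambda>\<mu>. p \<mu> + q \<mu>)"
  using assms unfolding source_finite_def
  by (rule finite_subset[OF _ finite_UnI, rotated])
     (force simp: image_iff)

lemma source_finite_uminus: "source_finite (\<lambda>\<mu>. - p \<mu>) \<longleftrightarrow> source_finite p"
  by (simp add: source_finite_def)

lemma source_finite_scale: "source_finite p \<Longrightarrow> source_finite (\<lambda>\<mu>. c * p \<mu>)"
  unfolding source_finite_def by (rule finite_subset[rotated]) auto

text \<open>The support of the image has at most one source: \<open>u\<close> for
  \<open>Vertex u\<close>, \<open>tail E e\<close> for \<open>Edge e\<close>,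
  \<open>head E e\<close> for \<open>Ghost e\<close>.\<close>

lemma source_finite_op_gen: "source_finite (op_gen E v x p)"
  unfolding source_finite_def
  by (rule finite_subset[of _ "case x of Vertex u \<Rightarrow> {u} | Edge e \<Rightarrow> {tail E e} | Ghost e \<Rightarrow> {head E e}"])
     (auto simp: op_defs split: lpa_gen.splits if_splits list.splits)

text \<open>The outermost letter of each word confines the image to one source, whatever the inner
  letters produce. A nonzero constant term would break this, since the empty word acts as the
  identity.\<close>

lemma source_finite_op_poly:
  assumes "f \<in> free_nonunital X"
  shows "source_finite (op_poly E v f p)"
proof (induction f rule: poly_mapping_single_add_induct)
  case (single w c)
  then obtain x xs where "letters w = x # xs"
    using assms by (auto simp: mem_free_nonunital_iff neq_Nil_conv)
  then show ?case
    by (simp add: op_poly_single op_word_def source_finite_op_gen source_finite_scale)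
qed (simp_all add: op_poly_zero op_poly_add source_finite_zero source_finite_add)

lemma abelian_group_path_series: "abelian_group (path_series E v)"
proof (rule abelian_groupI)
  fix p assume "p \<in> carrier (path_series E v)"
  then show "\<exists>q\<in>carrier (path_series E v).
      q \<oplus>\<^bsub>path_series E v\<^esub> p = \<zero>\<^bsub>path_series E v\<^esub>"
    by (intro bexI[of _ "\<lambda>\<mu>. - p \<mu>"]) (auto simp: mem_path_series_iff)
qed (auto simp: mem_path_series_iff algebra_simps)

lemma abelian_group_path_series_sf: "abelian_group (path_series_sf E v)"
proof (rule abelian_groupI)
  fix p assume "p \<in> carrier (path_series_sf E v)"
  then show "\<exists>q\<in>carrier (path_series_sf E v).
      q \<oplus>\<^bsub>path_series_sf E v\<^esub> p = \<zero>\<^bsub>path_series_sf E v\<^esub>"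
    by (intro bexI[of _ "\<lambda>\<mu>. - p \<mu>"])
       (auto simp: mem_path_series_sf_iff mem_path_series_iff source_finite_uminus)
qed (auto simp: mem_path_series_sf_iff mem_path_series_iff source_finite_zero source_finite_add
      algebra_simps)

text \<open>Outside the tree, adding or deleting a first edge respects entry paths by
  \<open>entry_paths_Cons\<close>. On the tree, the only value produced sits at an end of the edge,
  and both ends lie in the tree by \<open>tree_of_step\<close>.\<close>

lemma op_gen_closed:
  assumes "wf_digraph E" "x \<in> lpa_gens E" "p \<in> carrier (path_series E v)"
  shows "op_gen E v x p \<in> carrier (path_series E v)"
proof -
  note [simp] = entry_paths_Cons[OF assms(1)] entry_paths_Nil[OF assms(1)]
  note step = tree_of_step[OF assms(1)]
  show ?thesis
    using assms(2,3)
    by (cases x)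
       (auto simp: op_defs mem_path_series_iff lpa_gens_def step split: list.splits)
qed

lemma op_poly_closed:
  assumes "wf_digraph E" "f \<in> carrier (free_algebra (lpa_gens E))"
    and p: "p \<in> carrier (path_series E v)"
  shows "op_poly E v f p \<in> carrier (path_series E v)"
proof (induction f rule: poly_mapping_single_add_induct)
  case (single w c)
  then have "set (letters w) \<subseteq> lpa_gens E"
    using assms(2) by (auto simp: mem_free_algebra_iff)
  moreover have "foldr (op_gen E v) xs p \<in> carrier (path_series E v)"
    if "set xs \<subseteq> lpa_gens E" for xs
    using that by (induction xs) (simp_all add: p op_gen_closed[OF assms(1)])
  ultimately have "foldr (op_gen E v) (letters w) p \<in> carrier (path_series E v)"
    by blast
  then show ?case
    by (simp add: op_poly_single op_word_def mem_path_series_iff)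
qed (simp_all add: op_poly_zero op_poly_add mem_path_series_iff)


section \<open>The Leavitt path algebra relations hold for the operators\<close>

text \<open>The relations with vertices only compare sources. CK1 and CK2 carry the content: outside
  the tree they express that a path has one first edge, on the tree that an edge is the only one
  leaving its source.\<close>

lemma op_poly_relation:
  assumes E: "wf_digraph E" and v: "line_point E v"
    and r: "r \<in> lpa_relations E" and p: "p \<in> carrier (path_series E v)"
  shows "op_poly E v r p = (\<lambda>_. 0)"
proof -
  \<comment> \<open>Each of these three facts names pairs that are not entry paths, where
    \<open>p\<close> vanishes by the encoding of series.\<close>
  have p0: "p (u, es) = 0" if "u \<in> tree_of E v" "es \<noteq> []" for u es
    using p that entry_paths_tree[OF E that(1), of es] by (simp add: mem_path_series_iff)
  have p1: "p (u, []) = 0" if "u \<notin> tree_of E v" for u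
    using p that entry_paths_Nil[OF E, of u] by (simp add: mem_path_series_iff)
  have p2: "p (u, e # es) = 0" if "e \<notin> arcs E \<or> tail E e \<noteq> u" for u e es
    using p that entry_paths_Cons[OF E, of u e es] by (auto simp: mem_path_series_iff)
  have uniq: "e = f"
    if "e \<in> arcs E" "f \<in> arcs E" "tail E e = tail E f" "tail E f \<in> tree_of E v" for e f
    using v that by (force simp: line_point_def out_arcs_def)
  note step = tree_of_step[OF E]
  note rules = op_poly_diff op_poly_mult op_poly_gen op_poly_zero op_poly_sum op_defs fun_eq_iff
  consider
      (VV) u w where "r = gen (Vertex u) * gen (Vertex w) - (if u = w then gen (Vertex u) else 0)"
    | (VE) e where "e \<in> arcs E" "r = gen (Vertex (tail E e)) * gen (Edge e) - gen (Edge e)"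
    | (EV) e where "e \<in> arcs E" "r = gen (Edge e) * gen (Vertex (head E e)) - gen (Edge e)"
    | (VG) e where "e \<in> arcs E" "r = gen (Vertex (head E e)) * gen (Ghost e) - gen (Ghost e)"
    | (GV) e where "e \<in> arcs E" "r = gen (Ghost e) * gen (Vertex (tail E e)) - gen (Ghost e)"
    | (CK1) e f where "e \<in> arcs E" "f \<in> arcs E"
        "r = gen (Ghost e) * gen (Edge f) - (if e = f then gen (Vertex (head E e)) else 0)"
    | (CK2) u where "regular_vertex E u"
        "r = gen (Vertex u) - (\<Sum>e\<in>out_arcs E u. gen (Edge e) * gen (Ghost e))"
    using r unfolding lpa_relations_def by blast
  then show ?thesis
  proof cases
    case VV
    then show ?thesis by (auto simp: rules)
  next
    case VE
    then show ?thesis by (auto simp: rules split: list.splits)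
  next
    case EV
    then show ?thesis by (auto simp: rules split: list.splits)
  next
    case VG
    then show ?thesis by (auto simp: rules split: list.splits)
  next
    case GV
    then show ?thesis by (auto simp: rules split: list.splits)
  next
    case CK1
    \<comment> \<open>On the tree and for \<open>e = f\<close>, the composite is supported at the
      trivial path of \<open>head E f\<close>. It agrees with \<open>op_vertex\<close> because
      \<open>p\<close> vanishes at longer paths from there.\<close>
    have "p (head E f, es) = 0" if "tail E f \<in> tree_of E v" "es \<noteq> []" for es
      using p0 step CK1 that by blast
    \<comment> \<open>For distinct edges, \<open>uniq\<close> excludes a common source in the tree;
      outside the tree the first edges differ.\<close>
    then show ?thesis
      using CK1 uniq[of e f] by (auto simp: rules split: list.splits)
  next
    case CK2
    have u: "finite (out_arcs E u)" "out_arcs E u \<noteq> {}"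
      using CK2(1) by (auto simp: regular_vertex_def)
    have tail: "tail E e = u" if "e \<in> out_arcs E u" for e
      using that by (simp add: out_arcs_def)
    have "(\<Sum>e\<in>out_arcs E u. op_edge E v e (op_ghost E v e p) (w, es)) = op_vertex u p (w, es)"
      for w es
    proof (cases "u \<in> tree_of E v")
      case True
      \<comment> \<open>On the tree the sum has a single term, and both sides are supported at the
        trivial path of \<open>u\<close>.\<close>
      from u(2) obtain e where e: "e \<in> out_arcs E u" by blast
      then have "out_arcs E u = {e}"
        using uniq True by (auto simp: out_arcs_def)
      then show ?thesis
        using True tail[OF e] p0[OF True, of es] by (auto simp: op_defs)
    next
      case False
      \<comment> \<open>Outside the tree the term of \<open>e\<close> restricts \<open>p\<close> to
        the paths at \<open>u\<close> with first edge \<open>e\<close>, so at a given path at most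
        one term survives.\<close>
      have *: "op_edge E v e (op_ghost E v e p) (w, es) =
          (if w = u \<and> es \<noteq> [] \<and> hd es = e then p (w, es) else 0)" if "e \<in> out_arcs E u" for e
        using False tail[OF that] by (auto simp: op_defs split: list.splits)
      show ?thesis
      proof (cases "w = u \<and> es \<noteq> [] \<and> hd es \<in> out_arcs E u")
        case True
        then have "(\<Sum>e\<in>out_arcs E u. op_edge E v e (op_ghost E v e p) (w, es)) =
            (\<Sum>e\<in>out_arcs E u. if hd es = e then p (w, es) else 0)"
          using * by (intro sum.cong) auto
        then show ?thesis
          using True u(1) by (simp add: op_vertex_def)
      next
        \<comment> \<open>No term contributes. On the other side, the trivial path at
          \<open>u\<close> is not an entry path since \<open>u\<close> is outside the tree, and no
          path at \<open>u\<close> begins with an edge that does not leave \<open>u\<close>.\<close>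
        case no: False
        then have "op_vertex u p (w, es) = 0"
          using p1[OF False] p2 by (cases es) (auto simp: op_vertex_def out_arcs_def)
        moreover have "(\<Sum>e\<in>out_arcs E u. op_edge E v e (op_ghost E v e p) (w, es)) = 0"
          using no * by (intro sum.neutral) auto
        ultimately show ?thesis by simp
      qed
    qed
    then show ?thesis
      unfolding CK2(2)
      by (simp add: op_poly_diff op_poly_sum op_poly_mult op_poly_gen fun_eq_iff)
  qed
qed

text \<open>The polynomials annihilating the whole series space form a two-sided ideal
  \<open>J\<close>. It contains the relations, hence the ideal they generate.\<close>

lemma op_poly_lpa_ideal:
  fixes f :: "('a, 'b, 'k::field) lpa_free"
  assumes E: "wf_digraph E" and v: "line_point E v"
    and f: "f \<in> lpa_ideal E" and p: "p \<in> carrier (path_series E v)"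
  shows "op_poly E v f p = (\<lambda>_. 0)"
proof -
  let ?F = "free_algebra (lpa_gens E) :: ('a, 'b, 'k) lpa_free ring"
  interpret F: ring ?F by (rule ring_free_algebra)
  define J where "J = {f \<in> carrier ?F. \<forall>p\<in>carrier (path_series E v). op_poly E v f p = (\<lambda>_. 0)}"
  have inv: "\<ominus>\<^bsub>?F\<^esub> f = - f" if "f \<in> carrier ?F" for f
    using that F.minus_equality[of "- f" f] by (auto intro: free_algebra_closed)
  have "ideal J ?F"
  proof (rule idealI[OF ring_free_algebra])
    show "subgroup J (add_monoid ?F)"
    proof (rule F.add.subgroupI)
      show "J \<noteq> {}"
        by (auto simp: J_def op_poly_zero intro!: exI[of _ 0] free_algebra_closed)
      fix f g assume "f \<in> J" "g \<in> J"
      then show "f \<oplus>\<^bsub>?F\<^esub> g \<in> J"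
        by (auto simp: J_def op_poly_add free_algebra_closed)
    next
      fix f assume "f \<in> J"
      then show "\<ominus>\<^bsub>?F\<^esub> f \<in> J"
        using op_poly_diff[of E v 0 f] by (auto simp: J_def inv op_poly_zero free_algebra_closed)
    qed (auto simp: J_def)
  \<comment> \<open>A left factor sends the zero series to zero; a right factor maps the series
    space into itself, where the annihilator applies again.\<close>
  qed (auto simp: J_def op_poly_mult op_poly_zero_right op_poly_closed[OF E] free_algebra_closed)
  moreover have "lpa_relations E \<subseteq> J"
    using lpa_relations_subset[OF E] op_poly_relation[OF E v] by (auto simp: J_def)
  ultimately have "lpa_ideal E \<subseteq> J"
    unfolding lpa_ideal_def by (rule F.genideal_minimal)
  with f p show ?thesis
    by (auto simp: J_def)
qed


section \<open>The action\<close>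

text \<open>An element of \<open>lpa E\<close> is a coset of polynomials, so an arbitrary member is
  chosen and evaluated. Independence of the choice is \<open>lpa_act_class\<close>.\<close>

definition lpa_act :: "('a, 'b) pre_digraph \<Rightarrow> 'a \<Rightarrow> ('a, 'b, 'k::field) lpa_elem \<Rightarrow>
    ('a, 'b, 'k) series \<Rightarrow> ('a, 'b, 'k) series" where
  "lpa_act E v x = op_poly E v (SOME f. f \<in> x)"

text \<open>The chosen representative differs from \<open>f\<close> by an element of the ideal,
  which annihilates series supported on entry paths.\<close>

lemma lpa_act_class:
  assumes E: "wf_digraph E" and v: "line_point E v"
    and f: "f \<in> carrier (free_algebra (lpa_gens E))" and p: "p \<in> carrier (path_series E v)"
  shows "lpa_act E v (lpa_class E f) p = op_poly E v f p"
proof -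
  define g where "g = (SOME g. g \<in> lpa_class E f)"
  have "g \<in> lpa_class E f"
    unfolding g_def by (rule someI[of _ f]) (rule lpa_class_self[OF E f])
  then have "g - f \<in> lpa_ideal E"
    by (simp add: lpa_class_memD)
  then have "op_poly E v (g - f) p = (\<lambda>_. 0)"
    by (rule op_poly_lpa_ideal[OF E v _ p])
  then show ?thesis
    by (simp add: lpa_act_def g_def[symmetric] op_poly_diff fun_eq_iff)
qed

lemma series_action_lpa_act:
  assumes E: "wf_digraph E" and v: "line_point E v"
  shows "series_action E v (lpa_act E v :: ('a, 'b, 'k::field) lpa_elem \<Rightarrow> _)"
proof -
  note sub = subsetD[OF free_nonunital_subset]
  note act = lpa_act_class[OF E v]
  have "premodule (lpa E) (path_series E v) (lpa_act E v :: ('a, 'b, 'k) lpa_elem \<Rightarrow> _)"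
  proof (intro premodule.intro premodule_axioms.intro abelian_group_path_series,
      unfold lpa_carrier, safe)
    fix f g :: "('a, 'b, 'k) lpa_free" and p q :: "('a, 'b, 'k) series"
    assume f: "f \<in> free_nonunital (lpa_gens E)" and p: "p \<in> carrier (path_series E v)"
    show "lpa_act E v (lpa_class E f) p \<in> carrier (path_series E v)"
      using f p by (simp add: act sub op_poly_closed[OF E])
    show "lpa_act E v (lpa_class E f) (p \<oplus>\<^bsub>path_series E v\<^esub> q) =
        lpa_act E v (lpa_class E f) p \<oplus>\<^bsub>path_series E v\<^esub> lpa_act E v (lpa_class E f) q"
      if q: "q \<in> carrier (path_series E v)"
    proof -
      have "(\<lambda>\<mu>. p \<mu> + q \<mu>) \<in> carrier (path_series E v)"
        using p q by (simp add: mem_path_series_iff)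
      with f p q show ?thesis
        by (simp add: act sub op_poly_add_right)
    qed
    assume g: "g \<in> free_nonunital (lpa_gens E)"
    show "lpa_act E v (lpa_class E f \<oplus>\<^bsub>lpa E\<^esub> lpa_class E g) p =
        lpa_act E v (lpa_class E f) p \<oplus>\<^bsub>path_series E v\<^esub> lpa_act E v (lpa_class E g) p"
      using f g p by (simp add: act sub lpa_class_add[OF E] free_algebra_closed op_poly_add)
    show "lpa_act E v (lpa_class E f \<otimes>\<^bsub>lpa E\<^esub> lpa_class E g) p =
        lpa_act E v (lpa_class E f) (lpa_act E v (lpa_class E g) p)"
      using f g p
      by (simp add: act sub lpa_class_mult[OF E] free_algebra_closed op_poly_mult op_poly_closed[OF E])
  qed
  moreover have "lpa_act E v (c \<odot>\<^bsub>lpa E\<^esub> x) p = c \<odot>\<^bsub>path_series E v\<^esub> lpa_act E v x p \<and>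
      lpa_act E v x (c \<odot>\<^bsub>path_series E v\<^esub> p) = c \<odot>\<^bsub>path_series E v\<^esub> lpa_act E v x p"
    if x: "x \<in> carrier (lpa E)" and p: "p \<in> carrier (path_series E v)"
    for c and x :: "('a, 'b, 'k) lpa_elem" and p
  proof -
    obtain f where f: "f \<in> carrier (free_algebra (lpa_gens E))" "x = lpa_class E f"
      using x sub by (auto simp: lpa_carrier)
    have "(\<lambda>\<mu>. c * p \<mu>) \<in> carrier (path_series E v)"
      using p by (simp add: mem_path_series_iff)
    with f p show ?thesis
      by (simp add: act lpa_class_smult[OF E f(1)] free_algebra_closed op_poly_mult
          op_poly_scalar op_poly_scale_right)
  qed
  moreover have "lpa_act E v (lpa_class E (gen y)) p = op_gen E v y p"
    if "y \<in> lpa_gens E" "p \<in> carrier (path_series E v)"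
    for y and p :: "('a, 'b, 'k) series"
    using that by (simp add: act free_algebra_closed op_poly_gen)
  note this[of "Vertex _"] this[of "Edge _"] this[of "Ghost _"]
  ultimately show ?thesis
    by (auto simp: series_action_def lpa_gens_def)
qed

text \<open>This is the uniqueness of the action. Its values are forced on letters by the
  generators, on words by multiplicativity, and on polynomials by scalars and additivity.\<close>

lemma series_action_class:
  fixes act :: "('a, 'b, 'k::field) lpa_elem \<Rightarrow> ('a, 'b, 'k) series \<Rightarrow> ('a, 'b, 'k) series"
  assumes E: "wf_digraph E" and act: "series_action E v act"
    and f: "f \<in> free_nonunital (lpa_gens E)" and p: "p \<in> carrier (path_series E v)"
  shows "act (lpa_class E f) p = op_poly E v f p"
proof -
  let ?N = "free_nonunital (lpa_gens E) :: ('a, 'b, 'k) lpa_free set"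
  interpret premodule "lpa E" "path_series E v" act
    using act by (simp add: series_action_def)
  note sub = subsetD[OF free_nonunital_subset]
  have cls: "lpa_class E f \<in> carrier (lpa E)" if "f \<in> ?N" for f
    using that by (simp add: lpa_carrier)
  have scale: "act (lpa_class E (scalar c * f)) p = (\<lambda>\<mu>. c * act (lpa_class E f) p \<mu>)"
    if "f \<in> ?N" "p \<in> carrier (path_series E v)" for c f p
    using act that cls by (simp add: series_action_def lpa_class_smult[OF E, symmetric] sub)
  have gens: "act (lpa_class E (gen x)) p = op_gen E v x p"
    if "x \<in> lpa_gens E" "p \<in> carrier (path_series E v)" for x p
    using act that by (auto simp: series_action_def lpa_gens_def)
  \<comment> \<open>The induction starts at one-letter words, since the empty word is outside
    \<open>?N\<close>. Membership in \<open>?N\<close> is carried along because the premodule laws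
    hold only on the carrier.\<close>
  have word: "Poly_Mapping.single (Word xs) 1 \<in> ?N \<and>
      act (lpa_class E (Poly_Mapping.single (Word xs) 1)) p = op_word E v (Word xs) p"
    if "xs \<noteq> []" "set xs \<subseteq> lpa_gens E" for xs
    using that
  proof (induction xs)
    case (Cons x xs)
    show ?case
    proof (cases "xs = []")
      case True
      then show ?thesis
        using Cons.prems gens p free_nonunital_closed(4)[of x "lpa_gens E"]
        by (simp add: gen_def[symmetric] op_word_def)
    next
      case False
      let ?w = "Poly_Mapping.single (Word xs) 1 :: ('a, 'b, 'k) lpa_free"
      have eq: "Poly_Mapping.single (Word (x # xs)) 1 = gen x * ?w"
        by (simp add: gen_def mult_single plus_word_def)
      have x: "x \<in> lpa_gens E" and IH: "?w \<in> ?N" "act (lpa_class E ?w) p = op_word E v (Word xs) p"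
        using Cons False by auto
      have gx: "gen x \<in> ?N"
        using x by (rule free_nonunital_closed)
      have "act (lpa_class E (gen x * ?w)) p = act (lpa_class E (gen x)) (act (lpa_class E ?w) p)"
        using act_mult[OF cls[OF gx] cls[OF IH(1)] p] gx IH(1) by (simp add: lpa_class_mult[OF E] sub)
      also have "\<dots> = op_word E v (Word (x # xs)) p"
        using gens[OF x act_closed[OF cls[OF IH(1)] p]] IH(2) by (simp add: op_word_def)
      finally show ?thesis
        using free_nonunital_closed(2)[OF gx IH(1)] by (simp add: eq)
    qed
  qed simp
  have "f \<in> ?N \<and> act (lpa_class E f) p = op_poly E v f p"
  proof (induction f rule: poly_mapping_single_add_induct)
    case zero
    \<comment> \<open>Coefficient 0 in \<open>scale\<close> forces the class of 0 to act as
      zero.\<close>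
    have "act (lpa_class E 0) p = (\<lambda>\<mu>. 0 * act (lpa_class E 0) p \<mu>)"
      using scale[of 0 p 0] p by (simp add: free_nonunital_closed)
    then show ?case
      by (simp add: op_poly_zero free_nonunital_closed)
  next
    case (add g h)
    then show ?case
      using act_add_left[of "lpa_class E g" "lpa_class E h" p] p cls
      by (simp add: lpa_class_add[OF E] sub free_nonunital_closed op_poly_add)
  next
    case (single w c)
    then have "letters w \<noteq> []" "set (letters w) \<subseteq> lpa_gens E"
      using f by (auto simp: mem_free_nonunital_iff)
    from word[OF this] have w: "Poly_Mapping.single w 1 \<in> ?N"
        "act (lpa_class E (Poly_Mapping.single w 1)) p = op_word E v w p"
      by auto
    \<comment> \<open>The coefficient is split off as a scalar, since \<open>word\<close> treats
      only coefficient 1.\<close>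
    have "Poly_Mapping.single w c = scalar c * Poly_Mapping.single w 1"
      by (simp add: scalar_def mult_single)
    then show ?case
      using scale[OF w(1) p] w op_poly_single[of E v w 1 p]
      by (simp add: free_nonunital_closed op_poly_mult op_poly_scalar)
  qed
  then show ?thesis by simp
qed

text \<open>The element is the sum of the vertices at which \<open>p\<close> is supported. It
  depends on \<open>p\<close> and replaces a unit, which \<open>lpa E\<close> may lack.\<close>

lemma lpa_act_local_unit:
  fixes p :: "('a, 'b, 'k::field) series"
  assumes E: "wf_digraph E" and v: "line_point E v" and p: "p \<in> carrier (path_series_sf E v)"
  obtains x where "x \<in> carrier (lpa E)" "lpa_act E v x p = p"
proof
  have p': "p \<in> carrier (path_series E v)" and fin: "finite (fst ` {\<mu>. p \<mu> \<noteq> 0})"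
    using p by (auto simp: mem_path_series_sf_iff source_finite_def)
  let ?S = "fst ` {\<mu>. p \<mu> \<noteq> 0}"
  define f :: "('a, 'b, 'k) lpa_free" where "f = (\<Sum>u\<in>?S. gen (Vertex u))"
  \<comment> \<open>For infinite \<open>A\<close> the sum is 0 by convention, which also has no
    constant term.\<close>
  have "(\<Sum>u\<in>A. gen (Vertex u)) \<in> free_nonunital (lpa_gens E)" if "A \<subseteq> verts E" for A
    using that
    by (induction A rule: infinite_finite_induct) (auto simp: lpa_gens_def intro: free_nonunital_closed)
  \<comment> \<open>Sources of entry paths are vertices of the graph, so every summand of
    \<open>f\<close> is a generator.\<close>
  moreover have "?S \<subseteq> verts E"
    using p' entry_paths_source[OF E] by (force simp: mem_path_series_iff)
  ultimately have f: "f \<in> free_nonunital (lpa_gens E)"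
    by (simp add: f_def)
  then show "lpa_class E f \<in> carrier (lpa E)"
    by (simp add: lpa_carrier)
  have "op_poly E v f p = p"
    using fin by (force simp: f_def op_poly_sum op_poly_gen op_vertex_def fun_eq_iff)
  then show "lpa_act E v (lpa_class E f) p = p"
    using f p' by (simp add: lpa_act_class[OF E v] subsetD[OF free_nonunital_subset])
qed

text \<open>This serves two ends: the source finite series are stable under the action, and products
  with arbitrary series already land among them.\<close>

lemma lpa_act_source_finite:
  fixes x :: "('a, 'b, 'k::field) lpa_elem"
  assumes E: "wf_digraph E" and v: "line_point E v"
    and x: "x \<in> carrier (lpa E)" and p: "p \<in> carrier (path_series E v)"
  shows "lpa_act E v x p \<in> carrier (path_series_sf E v)"
proof -
  obtain f where f: "f \<in> free_nonunital (lpa_gens E)" "x = lpa_class E f"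
    using x by (auto simp: lpa_carrier)
  then show ?thesis
    using p source_finite_op_poly[OF f(1), of E v p]
    by (simp add: lpa_act_class[OF E v] subsetD[OF free_nonunital_subset]
        mem_path_series_sf_iff op_poly_closed[OF E])
qed

theorem proposition4p3:
  fixes E :: "('a, 'b) pre_digraph" and v :: 'a
  assumes "wf_digraph E"
    and "line_point E v"
  shows "\<exists>act :: ('a, 'b, 'k::field) lpa_elem \<Rightarrow> ('a, 'b, 'k) series \<Rightarrow> ('a, 'b, 'k) series.
    series_action E v act \<and>
    (\<forall>act'. series_action E v act' \<longrightarrow>
       (\<forall>x\<in>carrier (lpa E). \<forall>p\<in>carrier (path_series E v). act' x p = act x p)) \<and>
    unitary_module (lpa E) (path_series_sf E v) act \<and>
    carrier (path_series_sf E v) = act_span (lpa E) (path_series E v) act"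
proof -
  let ?R = "lpa E :: ('k, ('a, 'b, 'k) lpa_elem) module"
  let ?M = "path_series E v :: ('k, ('a, 'b, 'k) series) module"
  let ?N = "path_series_sf E v :: ('k, ('a, 'b, 'k) series) module"
  let ?act = "lpa_act E v :: ('a, 'b, 'k) lpa_elem \<Rightarrow> _"
  have action: "series_action E v ?act"
    by (rule series_action_lpa_act[OF assms])
  interpret M: premodule ?R ?M ?act
    using action by (simp add: series_action_def)
  interpret N: abelian_group ?N
    by (rule abelian_group_path_series_sf)
  have NM: "p \<in> carrier ?N \<Longrightarrow> p \<in> carrier ?M" for p
    by (simp add: mem_path_series_sf_iff)
  have sf: "?act x p \<in> carrier ?N" if "x \<in> carrier ?R" "p \<in> carrier ?M" for x p
    using that by (rule lpa_act_source_finite[OF assms])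
  \<comment> \<open>By its local unit, each \<open>p\<close> is itself a single product.
    \<open>G\<close> and \<open>L\<close> stay general so that the argument serves the spans over
    both \<open>?N\<close> and \<open>?M\<close>.\<close>
  have span: "p \<in> generate G {?act x q | x q. x \<in> carrier ?R \<and> q \<in> carrier L}"
    if p: "p \<in> carrier ?N" and "carrier ?N \<subseteq> carrier L"
    for p and G :: "(('a, 'b, 'k) series, 'z) monoid_scheme" and L :: "('k, ('a, 'b, 'k) series) module"
  proof -
    obtain x where "x \<in> carrier ?R" "?act x p = p"
      using lpa_act_local_unit[OF assms p] .
    with that show ?thesis
      by (intro generate.incl) (smt (verit) mem_Collect_eq subsetD)
  qed
  have "premodule ?R ?N ?act"
    using M.act_closed M.act_add_left M.act_add_right M.act_mult sf
    by unfold_locales (auto dest!: NM)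
  moreover have "act_span ?R ?N ?act = carrier ?N"
  proof
    show "act_span ?R ?N ?act \<subseteq> carrier ?N"
      unfolding act_span_def
      using N.add.generate_incl[of "{?act x p | x p. x \<in> carrier ?R \<and> p \<in> carrier ?N}"] sf NM
      by auto
    show "carrier ?N \<subseteq> act_span ?R ?N ?act"
      unfolding act_span_def by (intro subsetI span) auto
  qed
  ultimately have "unitary_module ?R ?N ?act"
    by (simp add: unitary_module_def unitary_module_axioms_def)
  moreover have "carrier ?N = act_span ?R ?M ?act"
  proof
    show "carrier ?N \<subseteq> act_span ?R ?M ?act"
      unfolding act_span_def by (intro subsetI span) (auto intro: NM)
    have minus: "\<ominus>\<^bsub>?M\<^esub> p = (\<lambda>\<mu>. - p \<mu>)" if "p \<in> carrier ?M" for p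
      using that by (intro M.minus_equality) (auto simp: mem_path_series_iff)
    \<comment> \<open>All products lie in \<open>?N\<close>, so the span taken inside
      \<open>?M\<close> stays there once \<open>?N\<close> is a subgroup.\<close>
    have "subgroup (carrier ?N) (add_monoid ?M)"
    proof (rule M.add.subgroupI)
      show "\<ominus>\<^bsub>?M\<^esub> p \<in> carrier ?N" if "p \<in> carrier ?N" for p
        using that by (simp add: minus mem_path_series_sf_iff mem_path_series_iff source_finite_uminus)
    qed (use N.zero_closed N.a_closed NM in auto)
    then show "act_span ?R ?M ?act \<subseteq> carrier ?N"
      unfolding act_span_def using sf by (intro M.add.generate_subgroup_incl) auto
  qed
  \<comment> \<open>Both actions evaluate the same polynomial representative of
    \<open>x\<close>.\<close>
  moreover have "act' x p = ?act x p"
    if act': "series_action E v act'" and x: "x \<in> carrier ?R" and p: "p \<in> carrier ?M"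
    for act' x p
    using x series_action_class[OF assms(1) act' _ p] series_action_class[OF assms(1) action _ p]
    by (auto simp: lpa_carrier)
  ultimately show ?thesis
    using action by blast
qed

end
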